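(* Let $P:\mathbb C^{\mathrm{op}}\to\mathbf{Pos}$ be a primary doctrine, $X$ an object of $\mathbb C$ and $\varphi\in P(X)$, and let $P_{(X,\varphi)}$ be the associated Kleisli doctrine with canonical 1-arrow $(F_X,\mathfrak f):P\to P_{(X,\varphi)}$. If $P$ is bounded, then $P_{(X,\varphi)}$ is bounded, and $(F_X,\mathfrak f)$ preserves the bottom element.
   Context: A doctrine is a functor $P:\mathbb C^{\mathrm{op}}\to\mathbf{Pos}$ with $\mathbb C$ a category with finite products and $\mathbf{Pos}$ the category of posets and monotone maps; the maps $P(f)$ are called reindexings. It is primary if every $P(A)$ has finite meets ($\wedge$, $\top$) and all reindexings preserve them. It is bounded if every $P(A)$ has a top and a bottom element and all reindexings preserve them. A 1-arrow (doctrine homomorphism) from $P:\mathbb C^{\mathrm{op}}\to\mathbf{Pos}$ to $R:\mathbb D^{\mathrm{op}}\to\mathbf{Pos}$ is a pair $(F,\mathfrak f)$ with $F:\mathbb C\to\mathbb D$ a finite-product-preserving functor and $\mathfrak f:P\to R\circ F^{\mathrm{op}}$ natural; it preserves the bottom element if $\mathfrak f_A(\bot_A)=\bot_{FA}$ for all $A$. Kleisli doctrine (the Kleisli object of the comonad on $P$ given by $X\times-$ and $\alpha\mapsto P(\mathrm{pr}_1)(\varphi)\wedge P(\mathrm{pr}_2)(\alpha)$). The category $\mathbb C_X$ has the same objects as $\mathbb C$; an arrow $g:A\rightsquigarrow B$ in $\mathbb C_X$ is a $\mathbb C$-arrow $g:X\times A\to B$; the identity of $A$ is $\mathrm{pr}_2:X\times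 A\to A$; the composite of $g:A\rightsquigarrow B$ and $h:B\rightsquigarrow C$ is $h\langle\mathrm{pr}_1,g\rangle$. It has finite products, given on objects by those of $\mathbb C$. The doctrine $P_{(X,\varphi)}:\mathbb C_X^{\mathrm{op}}\to\mathbf{Pos}$ has $P_{(X,\varphi)}(A)=\{\alpha\in P(X\times A)\mid\alpha\le P(\mathrm{pr}_1)(\varphi)\}$ with the order of $P(X\times A)$, and reindexing along $g:A\rightsquigarrow B$ is the restriction of $P(\langle\mathrm{pr}_1,g\rangle)$. The 1-arrow $(F_X,\mathfrak f):P\to P_{(X,\varphi)}$: $F_X:\mathbb C\to\mathbb C_X$ is the identity on objects and sends $f:A\to B$ to $f\,\mathrm{pr}_2:A\rightsquigarrow B$; $\mathfrak f_A(\alpha)=P(\mathrm{pr}_1)(\varphi)\wedge P(\mathrm{pr}_2)(\alpha)$, for $\mathrm{pr}_1,\mathrm{pr}_2$ the projections from $X\times A$. *)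

theory Defs
  imports "HOL-Algebra.Lattice"
begin

section \<open>Categories with finite products\<close>

text \<open>
  Hom-sets are indexed by source and target and need not be disjoint, so an element of a hom-set
  does not determine its source and target; composition and everything defined from it therefore
  carry the objects as arguments: \<open>Comp C A B D g f\<close> is \<open>g f\<close> for \<open>f : A \<rightarrow> B\<close>, \<open>g : B \<rightarrow> D\<close>.
  (In the Kleisli category below, \<open>X \<times> A = X \<times> A'\<close> may well hold for \<open>A \<noteq> A'\<close>.)
\<close>

record ('o, 'a) category =
  Obj :: "'o set"
  Hom :: "'o \<Rightarrow> 'o \<Rightarrow> 'a set"
  Ident :: "'o \<Rightarrow> 'a"
  Comp :: "'o \<Rightarrow> 'o \<Rightarrow> 'o \<Rightarrow> 'a \<Rightarrow> 'a \<Rightarrow> 'a"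

locale category =
  fixes C :: "('o, 'a, 'm) category_scheme"
  assumes ident_in_hom: "A \<in> Obj C \<Longrightarrow> Ident C A \<in> Hom C A A"
    and comp_in_hom:
      "\<lbrakk>A \<in> Obj C; B \<in> Obj C; D \<in> Obj C; f \<in> Hom C A B; g \<in> Hom C B D\<rbrakk>
        \<Longrightarrow> Comp C A B D g f \<in> Hom C A D"
    and comp_ident_right:
      "\<lbrakk>A \<in> Obj C; B \<in> Obj C; f \<in> Hom C A B\<rbrakk> \<Longrightarrow> Comp C A A B f (Ident C A) = f"
    and comp_ident_left:
      "\<lbrakk>A \<in> Obj C; B \<in> Obj C; f \<in> Hom C A B\<rbrakk> \<Longrightarrow> Comp C A B B (Ident C B) f = f"
    and comp_assoc:
      "\<lbrakk>A \<in> Obj C; B \<in> Obj C; D \<in> Obj C; E \<in> Obj C;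
        f \<in> Hom C A B; g \<in> Hom C B D; h \<in> Hom C D E\<rbrakk>
        \<Longrightarrow> Comp C A D E h (Comp C A B D g f) = Comp C A B E (Comp C B D E h g) f"

definition is_terminal :: "('o, 'a, 'm) category_scheme \<Rightarrow> 'o \<Rightarrow> bool" where
  "is_terminal C T \<longleftrightarrow> T \<in> Obj C \<and> (\<forall>A \<in> Obj C. \<exists>!u. u \<in> Hom C A T)"

definition is_product ::
  "('o, 'a, 'm) category_scheme \<Rightarrow> 'o \<Rightarrow> 'o \<Rightarrow> 'o \<Rightarrow> 'a \<Rightarrow> 'a \<Rightarrow> bool" where
  "is_product C A B Q p q \<longleftrightarrow>
     A \<in> Obj C \<and> B \<in> Obj C \<and> Q \<in> Obj C \<and> p \<in> Hom C Q A \<and> q \<in> Hom C Q B \<and>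
     (\<forall>Z \<in> Obj C. \<forall>f \<in> Hom C Z A. \<forall>g \<in> Hom C Z B.
        \<exists>!u. u \<in> Hom C Z Q \<and> Comp C Z Q A p u = f \<and> Comp C Z Q B q u = g)"

text \<open>Finite products are a chosen terminal object and chosen binary products.\<close>

record ('o, 'a) fp_category = "('o, 'a) category" +
  Terminal :: "'o"
  Prod :: "'o \<Rightarrow> 'o \<Rightarrow> 'o"
  Proj1 :: "'o \<Rightarrow> 'o \<Rightarrow> 'a"
  Proj2 :: "'o \<Rightarrow> 'o \<Rightarrow> 'a"

locale fp_category = category C for C :: "('o, 'a, 'm) fp_category_scheme" +
  assumes terminal: "is_terminal C (Terminal C)"
    and product:
      "\<lbrakk>A \<in> Obj C; B \<in> Obj C\<rbrakk> \<Longrightarrow> is_product C A B (Prod C A B) (Proj1 C A B) (Proj2 C A B)"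

text \<open>\<open>pairing C Z A B f g\<close> is \<open>\<langle>f, g\<rangle> : Z \<rightarrow> A \<times> B\<close>.\<close>

definition pairing ::
  "('o, 'a, 'm) fp_category_scheme \<Rightarrow> 'o \<Rightarrow> 'o \<Rightarrow> 'o \<Rightarrow> 'a \<Rightarrow> 'a \<Rightarrow> 'a" where
  "pairing C Z A B f g =
     (THE u. u \<in> Hom C Z (Prod C A B) \<and>
        Comp C Z (Prod C A B) A (Proj1 C A B) u = f \<and>
        Comp C Z (Prod C A B) B (Proj2 C A B) u = g)"


section \<open>Doctrines\<close>

text \<open>\<open>reindex P A B f\<close> is \<open>P(f) : P(B) \<rightarrow> P(A)\<close> for \<open>f : A \<rightarrow> B\<close>.\<close>

record ('o, 'a, 'p) doctrine =
  base :: "('o, 'a) fp_category"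
  fib :: "'o \<Rightarrow> 'p gorder"
  reindex :: "'o \<Rightarrow> 'o \<Rightarrow> 'a \<Rightarrow> 'p \<Rightarrow> 'p"

locale doctrine =
  fixes P :: "('o, 'a, 'p) doctrine"
  assumes base: "fp_category (base P)"
    and fib: "A \<in> Obj (base P) \<Longrightarrow> partial_order (fib P A)"
    and reindex_closed:
      "\<lbrakk>A \<in> Obj (base P); B \<in> Obj (base P); f \<in> Hom (base P) A B\<rbrakk>
        \<Longrightarrow> reindex P A B f \<in> carrier (fib P B) \<rightarrow> carrier (fib P A)"
    and reindex_mono:
      "\<lbrakk>A \<in> Obj (base P); B \<in> Obj (base P); f \<in> Hom (base P) A B\<rbrakk>
        \<Longrightarrow> isotone (fib P B) (fib P A) (reindex P A B f)"
    and reindex_ident: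
      "\<lbrakk>A \<in> Obj (base P); \<alpha> \<in> carrier (fib P A)\<rbrakk>
        \<Longrightarrow> reindex P A A (Ident (base P) A) \<alpha> = \<alpha>"
    and reindex_comp:
      "\<lbrakk>A \<in> Obj (base P); B \<in> Obj (base P); D \<in> Obj (base P);
        f \<in> Hom (base P) A B; g \<in> Hom (base P) B D; \<alpha> \<in> carrier (fib P D)\<rbrakk>
        \<Longrightarrow> reindex P A D (Comp (base P) A B D g f) \<alpha> = reindex P A B f (reindex P B D g \<alpha>)"

locale primary_doctrine = doctrine P for P :: "('o, 'a, 'p) doctrine" +
  assumes fib_meets: "A \<in> Obj (base P) \<Longrightarrow> lower_semilattice (fib P A)"
    and fib_top: "A \<in> Obj (base P) \<Longrightarrow> weak_partial_order_top (fib P A)"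
    and reindex_meet:
      "\<lbrakk>A \<in> Obj (base P); B \<in> Obj (base P); f \<in> Hom (base P) A B;
        \<alpha> \<in> carrier (fib P B); \<beta> \<in> carrier (fib P B)\<rbrakk>
        \<Longrightarrow> reindex P A B f (\<alpha> \<sqinter>\<^bsub>fib P B\<^esub> \<beta>) = reindex P A B f \<alpha> \<sqinter>\<^bsub>fib P A\<^esub> reindex P A B f \<beta>"
    and reindex_top:
      "\<lbrakk>A \<in> Obj (base P); B \<in> Obj (base P); f \<in> Hom (base P) A B\<rbrakk>
        \<Longrightarrow> reindex P A B f \<top>\<^bsub>fib P B\<^esub> = \<top>\<^bsub>fib P A\<^esub>"

locale bounded_doctrine = doctrine P for P :: "('o, 'a, 'p) doctrine" +
  assumes fib_top: "A \<in> Obj (base P) \<Longrightarrow> weak_partial_order_top (fib P A)"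
    and fib_bottom: "A \<in> Obj (base P) \<Longrightarrow> weak_partial_order_bottom (fib P A)"
    and reindex_top:
      "\<lbrakk>A \<in> Obj (base P); B \<in> Obj (base P); f \<in> Hom (base P) A B\<rbrakk>
        \<Longrightarrow> reindex P A B f \<top>\<^bsub>fib P B\<^esub> = \<top>\<^bsub>fib P A\<^esub>"
    and reindex_bottom:
      "\<lbrakk>A \<in> Obj (base P); B \<in> Obj (base P); f \<in> Hom (base P) A B\<rbrakk>
        \<Longrightarrow> reindex P A B f \<bottom>\<^bsub>fib P B\<^esub> = \<bottom>\<^bsub>fib P A\<^esub>"


section \<open>1-arrows of doctrines\<close>

record ('o, 'a, 'o2, 'a2) functor_data =
  on_obj :: "'o \<Rightarrow> 'o2"
  on_hom :: "'o \<Rightarrow> 'o \<Rightarrow> 'a \<Rightarrow> 'a2"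

text \<open>
  Preservation of finite products means that terminal objects and product cones are sent to such;
  the chosen products need not be sent to the chosen ones.
\<close>

locale fp_functor = src: category C + tgt: category D
  for C :: "('o, 'a, 'm) category_scheme"
    and D :: "('o2, 'a2, 'n) category_scheme"
    and F :: "('o, 'a, 'o2, 'a2) functor_data" +
  assumes on_obj_closed: "A \<in> Obj C \<Longrightarrow> on_obj F A \<in> Obj D"
    and on_hom_closed:
      "\<lbrakk>A \<in> Obj C; B \<in> Obj C; f \<in> Hom C A B\<rbrakk>
        \<Longrightarrow> on_hom F A B f \<in> Hom D (on_obj F A) (on_obj F B)"
    and on_hom_ident:
      "A \<in> Obj C \<Longrightarrow> on_hom F A A (Ident C A) = Ident D (on_obj F A)"
    and on_hom_comp:
      "\<lbrakk>A \<in> Obj C; B \<in> Obj C; E \<in> Obj C; f \<in> Hom C A B; g \<in> Hom C B E\<rbrakk>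
        \<Longrightarrow> on_hom F A E (Comp C A B E g f) =
              Comp D (on_obj F A) (on_obj F B) (on_obj F E) (on_hom F B E g) (on_hom F A B f)"
    and preserves_terminal: "is_terminal C T \<Longrightarrow> is_terminal D (on_obj F T)"
    and preserves_product:
      "is_product C A B Q p q
        \<Longrightarrow> is_product D (on_obj F A) (on_obj F B) (on_obj F Q) (on_hom F Q A p) (on_hom F Q B q)"

record ('o, 'a, 'p, 'o2, 'a2, 'p2) doctrine_arrow =
  fun_part :: "('o, 'a, 'o2, 'a2) functor_data"
  component :: "'o \<Rightarrow> 'p \<Rightarrow> 'p2"

locale doctrine_hom = src: doctrine P + tgt: doctrine R
  for P :: "('o, 'a, 'p) doctrine"
    and R :: "('o2, 'a2, 'p2) doctrine"
    and H :: "('o, 'a, 'p, 'o2, 'a2, 'p2) doctrine_arrow" +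
  assumes fun_part: "fp_functor (base P) (base R) (fun_part H)"
    and component_closed:
      "A \<in> Obj (base P)
        \<Longrightarrow> component H A \<in> carrier (fib P A) \<rightarrow> carrier (fib R (on_obj (fun_part H) A))"
    and component_mono:
      "A \<in> Obj (base P)
        \<Longrightarrow> isotone (fib P A) (fib R (on_obj (fun_part H) A)) (component H A)"
    and component_natural:
      "\<lbrakk>A \<in> Obj (base P); B \<in> Obj (base P); f \<in> Hom (base P) A B; \<beta> \<in> carrier (fib P B)\<rbrakk>
        \<Longrightarrow> component H A (reindex P A B f \<beta>) =
              reindex R (on_obj (fun_part H) A) (on_obj (fun_part H) B)
                (on_hom (fun_part H) A B f) (component H B \<beta>)"

definition preserves_bottom ::
  "('o, 'a, 'p) doctrine \<Rightarrow> ('o2, 'a2, 'p2) doctrine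
    \<Rightarrow> ('o, 'a, 'p, 'o2, 'a2, 'p2) doctrine_arrow \<Rightarrow> bool" where
  "preserves_bottom P R H \<longleftrightarrow>
     (\<forall>A \<in> Obj (base P). component H A \<bottom>\<^bsub>fib P A\<^esub> = \<bottom>\<^bsub>fib R (on_obj (fun_part H) A)\<^esub>)"


section \<open>The Kleisli doctrine\<close>

text \<open>For \<open>g : X \<times> A \<rightarrow> B\<close>, the arrow \<open>\<langle>pr\<^sub>1, g\<rangle> : X \<times> A \<rightarrow> X \<times> B\<close>.\<close>

definition kleisli_lift ::
  "('o, 'a, 'm) fp_category_scheme \<Rightarrow> 'o \<Rightarrow> 'o \<Rightarrow> 'o \<Rightarrow> 'a \<Rightarrow> 'a" where
  "kleisli_lift C X A B g = pairing C (Prod C X A) X B (Proj1 C X A) g"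

text \<open>The functor \<open>F\<^sub>X\<close>, sending \<open>f : A \<rightarrow> B\<close> to \<open>f pr\<^sub>2 : X \<times> A \<rightarrow> B\<close>.\<close>

definition kleisli_functor ::
  "('o, 'a, 'm) fp_category_scheme \<Rightarrow> 'o \<Rightarrow> ('o, 'a, 'o, 'a) functor_data" where
  "kleisli_functor C X =
     \<lparr> on_obj = (\<lambda>A. A),
       on_hom = (\<lambda>A B f. Comp C (Prod C X A) A B f (Proj2 C X A)) \<rparr>"

text \<open>The projections of the products in \<open>C\<^sub>X\<close> are the images under \<open>F\<^sub>X\<close> of those in \<open>C\<close>.\<close>

definition kleisli_category ::
  "('o, 'a) fp_category \<Rightarrow> 'o \<Rightarrow> ('o, 'a) fp_category" where
  "kleisli_category C X =
     \<lparr> Obj = Obj C,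
       Hom = (\<lambda>A B. Hom C (Prod C X A) B),
       Ident = (\<lambda>A. Proj2 C X A),
       Comp = (\<lambda>A B D h g. Comp C (Prod C X A) (Prod C X B) D h (kleisli_lift C X A B g)),
       Terminal = Terminal C,
       Prod = Prod C,
       Proj1 = (\<lambda>A B. on_hom (kleisli_functor C X) (Prod C A B) A (Proj1 C A B)),
       Proj2 = (\<lambda>A B. on_hom (kleisli_functor C X) (Prod C A B) B (Proj2 C A B)) \<rparr>"

definition kleisli_doctrine ::
  "('o, 'a, 'p) doctrine \<Rightarrow> 'o \<Rightarrow> 'p \<Rightarrow> ('o, 'a, 'p) doctrine" where
  "kleisli_doctrine P X \<phi> =
     (let C = base P in
      \<lparr> base = kleisli_category C X,
        fib = (\<lambda>A. (fib P (Prod C X A))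
                \<lparr> carrier := {\<alpha> \<in> carrier (fib P (Prod C X A)).
                    \<alpha> \<sqsubseteq>\<^bsub>fib P (Prod C X A)\<^esub> reindex P (Prod C X A) X (Proj1 C X A) \<phi>} \<rparr>),
        reindex = (\<lambda>A B g. reindex P (Prod C X A) (Prod C X B) (kleisli_lift C X A B g)) \<rparr>)"

definition kleisli_arrow ::
  "('o, 'a, 'p) doctrine \<Rightarrow> 'o \<Rightarrow> 'p \<Rightarrow> ('o, 'a, 'p, 'o, 'a, 'p) doctrine_arrow" where
  "kleisli_arrow P X \<phi> =
     (let C = base P in
      \<lparr> fun_part = kleisli_functor C X,
        component = (\<lambda>A \<alpha>.
          reindex P (Prod C X A) X (Proj1 C X A) \<phi>
            \<sqinter>\<^bsub>fib P (Prod C X A)\<^esub> reindex P (Prod C X A) A (Proj2 C X A) \<alpha>) \<rparr>)"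

end

theory Submission
  imports Defs
begin

text \<open>
  The lift \<open>g \<mapsto> \<langle>pr\<^sub>1, g\<rangle>\<close> turns Kleisli composition into composition in \<open>C\<close> and satisfies
  \<open>pr\<^sub>1 \<langle>pr\<^sub>1, g\<rangle> = pr\<^sub>1\<close>.  Hence reindexing along a lift \<open>X \<times> A \<rightarrow> X \<times> B\<close> sends the element
  \<open>P(pr\<^sub>1)(\<phi>)\<close> over \<open>X \<times> B\<close> to the one over \<open>X \<times> A\<close>, so it restricts to their down-sets and
  preserves the tops of these.  A down-set has the bottom of the whole poset; every reindexing
  preserves it, and meeting it with \<open>P(pr\<^sub>1)(\<phi>)\<close> does not change it.
\<close>

section \<open>Down-sets of posets\<close>

text \<open>The record update changes the carrier but neither the order nor \<open>.=\<close>, so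
  the axioms restrict to the subset.\<close>

lemma (in partial_order) partial_order_downset:
  "partial_order (L\<lparr>carrier := {x \<in> carrier L. x \<sqsubseteq> a}\<rparr>)"
  by unfold_locales (auto simp: eq_is_equal intro: le_trans)

lemma (in weak_partial_order_bottom) least_downset:
  assumes "a \<in> carrier L"
  shows "least (L\<lparr>carrier := {x \<in> carrier L. x \<sqsubseteq> a}\<rparr>) \<bottom> {x \<in> carrier L. x \<sqsubseteq> a}"
  using assms by (simp add: least_def)

lemma (in weak_partial_order) greatest_downset:
  assumes "a \<in> carrier L"
  shows "greatest (L\<lparr>carrier := {x \<in> carrier L. x \<sqsubseteq> a}\<rparr>) a {x \<in> carrier L. x \<sqsubseteq> a}"
  using assms by (simp add: greatest_def)

text \<open>The bottom is a Hilbert choice among least elements. These agree up to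
  \<open>.=\<close>, which is equality in a partial order, so exhibiting any least element
  identifies it.\<close>

lemma (in partial_order) bottom_equality:
  assumes "least L b (carrier L)"
  shows "\<bottom> = b"
  unfolding bottom_def using assms weak_least_unique eq_is_equal
  by (metis (mono_tags) someI)

lemma (in partial_order) top_equality:
  assumes "greatest L t (carrier L)"
  shows "\<top> = t"
  unfolding top_def using assms weak_greatest_unique eq_is_equal
  by (metis (mono_tags) someI)


section \<open>The Kleisli category\<close>

context fp_category
begin

lemma
  assumes "A \<in> Obj C" "B \<in> Obj C"
  shows Prod_obj: "Prod C A B \<in> Obj C"
    and Proj1_in_hom: "Proj1 C A B \<in> Hom C (Prod C A B) A"
    and Proj2_in_hom: "Proj2 C A B \<in> Hom C (Prod C A B) B"
  using product[OF assms] by (simp_all add: is_product_def)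

text \<open>\<open>pairing\<close> is a definite description, so it meets its specification only
  once the universal property has supplied unique existence.\<close>

lemma pairing:
  assumes "Z \<in> Obj C" "A \<in> Obj C" "B \<in> Obj C" "f \<in> Hom C Z A" "g \<in> Hom C Z B"
  shows pairing_in_hom: "pairing C Z A B f g \<in> Hom C Z (Prod C A B)"
    and Proj1_pairing: "Comp C Z (Prod C A B) A (Proj1 C A B) (pairing C Z A B f g) = f"
    and Proj2_pairing: "Comp C Z (Prod C A B) B (Proj2 C A B) (pairing C Z A B f g) = g"
proof -
  have "\<exists>!u. u \<in> Hom C Z (Prod C A B) \<and> Comp C Z (Prod C A B) A (Proj1 C A B) u = f \<and>
      Comp C Z (Prod C A B) B (Proj2 C A B) u = g"
    using product[OF assms(2,3)] assms by (simp add: is_product_def)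
  from theI'[OF this]
  show "pairing C Z A B f g \<in> Hom C Z (Prod C A B)"
    and "Comp C Z (Prod C A B) A (Proj1 C A B) (pairing C Z A B f g) = f"
    and "Comp C Z (Prod C A B) B (Proj2 C A B) (pairing C Z A B f g) = g"
    by (simp_all add: pairing_def)
qed

text \<open>The projections are jointly monic: this is the uniqueness half of the universal
  property, in the form used to compare lifts.\<close>

lemma Prod_arrow_eqI:
  assumes "Z \<in> Obj C" "A \<in> Obj C" "B \<in> Obj C"
    and "u \<in> Hom C Z (Prod C A B)" "v \<in> Hom C Z (Prod C A B)"
    and "Comp C Z (Prod C A B) A (Proj1 C A B) u = Comp C Z (Prod C A B) A (Proj1 C A B) v"
    and "Comp C Z (Prod C A B) B (Proj2 C A B) u = Comp C Z (Prod C A B) B (Proj2 C A B) v"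
  shows "u = v"
proof -
  \<comment> \<open>The cone is built from the components of \<open>v\<close>; then \<open>u\<close>
    and \<open>v\<close> both mediate it.\<close>
  let ?f = "Comp C Z (Prod C A B) A (Proj1 C A B) v"
  let ?g = "Comp C Z (Prod C A B) B (Proj2 C A B) v"
  have "?f \<in> Hom C Z A" "?g \<in> Hom C Z B"
    using assms by (auto intro!: comp_in_hom Prod_obj Proj1_in_hom Proj2_in_hom)
  then have "\<exists>!u. u \<in> Hom C Z (Prod C A B) \<and> Comp C Z (Prod C A B) A (Proj1 C A B) u = ?f \<and>
      Comp C Z (Prod C A B) B (Proj2 C A B) u = ?g"
    using product[OF assms(2,3)] assms(1) by (simp add: is_product_def)
  then show ?thesis
    using assms by blast
qed

end

section \<open>The lift of Kleisli arrows and its functoriality\<close>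

locale kleisli_base = fp_category C for C :: "('o, 'a) fp_category" +
  fixes X :: 'o
  assumes X_obj: "X \<in> Obj C"
begin

lemmas X_Prod_obj = Prod_obj[OF X_obj]
  and X_Proj1_in_hom = Proj1_in_hom[OF X_obj]
  and X_Proj2_in_hom = Proj2_in_hom[OF X_obj]

lemma kleisli_lift:
  assumes "A \<in> Obj C" "B \<in> Obj C" "g \<in> Hom C (Prod C X A) B"
  shows kleisli_lift_in_hom: "kleisli_lift C X A B g \<in> Hom C (Prod C X A) (Prod C X B)"
    and Proj1_kleisli_lift:
      "Comp C (Prod C X A) (Prod C X B) X (Proj1 C X B) (kleisli_lift C X A B g) = Proj1 C X A"
    and Proj2_kleisli_lift:
      "Comp C (Prod C X A) (Prod C X B) B (Proj2 C X B) (kleisli_lift C X A B g) = g"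
  unfolding kleisli_lift_def
  using pairing[OF X_Prod_obj X_obj _ X_Proj1_in_hom] assms by blast+

text \<open>Both sides have components \<open>pr1\<close> and \<open>pr2\<close>. Together with
  \<open>kleisli_lift_comp\<close> this makes lifting a functor from the Kleisli category to
  \<open>C\<close>, sending \<open>A\<close> to \<open>Prod C X A\<close>; the laws of the Kleisli
  category and of its reindexings follow from those below.\<close>

lemma kleisli_lift_Proj2:
  assumes "A \<in> Obj C"
  shows "kleisli_lift C X A A (Proj2 C X A) = Ident C (Prod C X A)"
  by (rule Prod_arrow_eqI[of "Prod C X A" X A])
    (simp_all add: assms X_obj kleisli_lift X_Prod_obj X_Proj1_in_hom X_Proj2_in_hom
      ident_in_hom comp_ident_right)

text \<open>Projections decide: after associativity, the first component of each side is
  \<open>pr1\<close> and the second is the Kleisli composite \<open>?k\<close>.\<close>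

lemma kleisli_lift_comp:
  assumes "A \<in> Obj C" "B \<in> Obj C" "D \<in> Obj C"
    and "g \<in> Hom C (Prod C X A) B" "h \<in> Hom C (Prod C X B) D"
  shows "kleisli_lift C X A D (Comp C (Prod C X A) (Prod C X B) D h (kleisli_lift C X A B g)) =
    Comp C (Prod C X A) (Prod C X B) (Prod C X D) (kleisli_lift C X B D h) (kleisli_lift C X A B g)"
    (is "kleisli_lift C X A D ?k = ?r")
proof (rule Prod_arrow_eqI[of "Prod C X A" X D])
  have k: "?k \<in> Hom C (Prod C X A) D"
    using assms by (intro comp_in_hom[of _ "Prod C X B"] X_Prod_obj kleisli_lift)
  then show "kleisli_lift C X A D ?k \<in> Hom C (Prod C X A) (Prod C X D)"
    using assms by (intro kleisli_lift)
  show "?r \<in> Hom C (Prod C X A) (Prod C X D)"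
    using assms by (intro comp_in_hom[of _ "Prod C X B"] X_Prod_obj kleisli_lift)
  show "Comp C (Prod C X A) (Prod C X D) X (Proj1 C X D) (kleisli_lift C X A D ?k) =
      Comp C (Prod C X A) (Prod C X D) X (Proj1 C X D) ?r"
    using assms k X_obj
    by (subst comp_assoc[of _ "Prod C X B"])
      (simp_all add: kleisli_lift X_Prod_obj X_Proj1_in_hom)
  show "Comp C (Prod C X A) (Prod C X D) D (Proj2 C X D) (kleisli_lift C X A D ?k) =
      Comp C (Prod C X A) (Prod C X D) D (Proj2 C X D) ?r"
    using assms k X_obj
    by (subst comp_assoc[of _ "Prod C X B"])
      (simp_all add: kleisli_lift X_Prod_obj X_Proj2_in_hom)
qed (use assms X_obj in \<open>simp_all add: X_Prod_obj\<close>)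

text \<open>The left side is the Kleisli composite of the image of \<open>f\<close> under the
  canonical functor with \<open>g\<close>. Since \<open>pr2\<close> after the lift is
  \<open>g\<close>, it is an ordinary composite, so cones made of such images can be tested in
  \<open>C\<close>.\<close>

lemma Proj2_comp_kleisli_lift:
  assumes "A \<in> Obj C" "B \<in> Obj C" "D \<in> Obj C"
    and "g \<in> Hom C (Prod C X A) B" "f \<in> Hom C B D"
  shows "Comp C (Prod C X A) (Prod C X B) D (Comp C (Prod C X B) B D f (Proj2 C X B))
      (kleisli_lift C X A B g) = Comp C (Prod C X A) B D f g"
  using assms by (subst comp_assoc[symmetric])
    (simp_all add: kleisli_lift X_Prod_obj X_Proj2_in_hom)

lemma kleisli_category_simps:
  "Obj (kleisli_category C X) = Obj C"
  "Hom (kleisli_category C X) A B = Hom C (Prod C X A) B"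
  "Ident (kleisli_category C X) A = Proj2 C X A"
  "Comp (kleisli_category C X) A B D h g =
    Comp C (Prod C X A) (Prod C X B) D h (kleisli_lift C X A B g)"
  "Terminal (kleisli_category C X) = Terminal C"
  "Prod (kleisli_category C X) = Prod C"
  "Proj1 (kleisli_category C X) A B = on_hom (kleisli_functor C X) (Prod C A B) A (Proj1 C A B)"
  "Proj2 (kleisli_category C X) A B = on_hom (kleisli_functor C X) (Prod C A B) B (Proj2 C A B)"
  by (simp_all add: kleisli_category_def)

lemma kleisli_functor_simps:
  "on_obj (kleisli_functor C X) A = A"
  "on_hom (kleisli_functor C X) A B f = Comp C (Prod C X A) A B f (Proj2 C X A)"
  by (simp_all add: kleisli_functor_def)

section \<open>Category laws, finite products and the canonical functor\<close>

lemma category_kleisli_category: "category (kleisli_category C X)"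
proof
  fix A B D E f g h
  assume "A \<in> Obj (kleisli_category C X)" "B \<in> Obj (kleisli_category C X)"
    "D \<in> Obj (kleisli_category C X)" "E \<in> Obj (kleisli_category C X)"
    "f \<in> Hom (kleisli_category C X) A B" "g \<in> Hom (kleisli_category C X) B D"
    "h \<in> Hom (kleisli_category C X) D E"
  then show "Comp (kleisli_category C X) A D E h (Comp (kleisli_category C X) A B D g f) =
      Comp (kleisli_category C X) A B E (Comp (kleisli_category C X) B D E h g) f"
    \<comment> \<open>Once the lift of a composite is the composite of lifts, this is associativity
      in \<open>C\<close>.\<close>
    by (simp add: kleisli_category_simps kleisli_lift_comp comp_assoc X_Prod_obj kleisli_lift)
qed (simp_all add: kleisli_category_simps X_Proj2_in_hom kleisli_lift_Proj2 comp_ident_right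
    kleisli_lift X_Prod_obj comp_in_hom[of _ "Prod C X _"])

text \<open>Kleisli arrows from \<open>A\<close> to \<open>T\<close> are arrows of \<open>C\<close>
  from \<open>Prod C X A\<close> to \<open>T\<close>, of which there is exactly one.\<close>

lemma is_terminal_kleisli_category:
  assumes "is_terminal C T"
  shows "is_terminal (kleisli_category C X) T"
  using assms by (simp add: is_terminal_def kleisli_category_simps X_Prod_obj)

lemma is_product_kleisli_category:
  assumes "is_product C A B Q p q"
  shows "is_product (kleisli_category C X) A B Q
    (on_hom (kleisli_functor C X) Q A p) (on_hom (kleisli_functor C X) Q B q)"
proof -
  have obj: "A \<in> Obj C" "B \<in> Obj C" "Q \<in> Obj C" and pq: "p \<in> Hom C Q A" "q \<in> Hom C Q B"
    and univ: "\<And>Z f g. \<lbrakk>Z \<in> Obj C; f \<in> Hom C Z A; g \<in> Hom C Z B\<rbrakk> \<Longrightarrow>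
      \<exists>!u. u \<in> Hom C Z Q \<and> Comp C Z Q A p u = f \<and> Comp C Z Q B q u = g"
    using assms by (simp_all add: is_product_def)
  have "\<exists>!u. u \<in> Hom C (Prod C X Z) Q \<and>
      Comp C (Prod C X Z) (Prod C X Q) A (Comp C (Prod C X Q) Q A p (Proj2 C X Q))
        (kleisli_lift C X Z Q u) = f \<and>
      Comp C (Prod C X Z) (Prod C X Q) B (Comp C (Prod C X Q) Q B q (Proj2 C X Q))
        (kleisli_lift C X Z Q u) = g"
    if "Z \<in> Obj C" "f \<in> Hom C (Prod C X Z) A" "g \<in> Hom C (Prod C X Z) B" for Z f g
    \<comment> \<open>A Kleisli cone with vertex \<open>Z\<close> is a cone in \<open>C\<close> with
      vertex \<open>Prod C X Z\<close>, and the mediating arrow is the same.\<close>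
    using univ[OF X_Prod_obj that(2,3)] that obj pq
    \<comment> \<open>\<open>conj_cong\<close> makes the membership of \<open>u\<close> in its
      hom-set available while the two equations beside it are rewritten.\<close>
    by (simp add: Proj2_comp_kleisli_lift cong: conj_cong)
  moreover have "Comp C (Prod C X Q) Q A p (Proj2 C X Q) \<in> Hom C (Prod C X Q) A"
    "Comp C (Prod C X Q) Q B q (Proj2 C X Q) \<in> Hom C (Prod C X Q) B"
    using obj pq by (auto intro: comp_in_hom[of _ Q] X_Prod_obj X_Proj2_in_hom)
  ultimately show ?thesis
    using obj by (simp add: is_product_def kleisli_category_simps kleisli_functor_simps)
qed

lemma fp_category_kleisli_category: "fp_category (kleisli_category C X)"
proof (intro fp_category.intro category_kleisli_category fp_category_axioms.intro)
  show "is_terminal (kleisli_category C X) (Terminal (kleisli_category C X))"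
    using is_terminal_kleisli_category[OF terminal] by (simp add: kleisli_category_simps)
next
  fix A B assume "A \<in> Obj (kleisli_category C X)" "B \<in> Obj (kleisli_category C X)"
  then show "is_product (kleisli_category C X) A B (Prod (kleisli_category C X) A B)
      (Proj1 (kleisli_category C X) A B) (Proj2 (kleisli_category C X) A B)"
    unfolding kleisli_category_simps by (intro is_product_kleisli_category product)
qed

lemma fp_functor_kleisli_functor: "fp_functor C (kleisli_category C X) (kleisli_functor C X)"
proof -
  interpret K: category "kleisli_category C X"
    by (rule category_kleisli_category)
  show ?thesis
  proof
    fix A B E f g
    assume "A \<in> Obj C" "B \<in> Obj C" "E \<in> Obj C" "f \<in> Hom C A B" "g \<in> Hom C B E"
    moreover from this have "Comp C (Prod C X A) A B f (Proj2 C X A) \<in> Hom C (Prod C X A) B"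
      by (auto intro: comp_in_hom[of _ A] X_Prod_obj X_Proj2_in_hom)
    ultimately show "on_hom (kleisli_functor C X) A E (Comp C A B E g f) =
        Comp (kleisli_category C X) (on_obj (kleisli_functor C X) A)
          (on_obj (kleisli_functor C X) B) (on_obj (kleisli_functor C X) E)
          (on_hom (kleisli_functor C X) B E g) (on_hom (kleisli_functor C X) A B f)"
      \<comment> \<open>The right side is \<open>g pr2\<close> after the lift of
        \<open>f pr2\<close>, which collapses to \<open>g (f pr2)\<close>; associativity does the
        rest.\<close>
      by (simp add: kleisli_category_simps kleisli_functor_simps Proj2_comp_kleisli_lift
          comp_assoc X_Prod_obj X_Proj2_in_hom)
  next
    fix A B Q p q
    assume "is_product C A B Q p q"
    then show "is_product (kleisli_category C X) (on_obj (kleisli_functor C X) A)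
        (on_obj (kleisli_functor C X) B) (on_obj (kleisli_functor C X) Q)
        (on_hom (kleisli_functor C X) Q A p) (on_hom (kleisli_functor C X) Q B q)"
      unfolding kleisli_functor_simps(1) by (rule is_product_kleisli_category)
  qed (auto simp: kleisli_category_simps kleisli_functor_simps is_terminal_kleisli_category
      comp_ident_left X_Prod_obj X_Proj2_in_hom intro: comp_in_hom)
qed

end


section \<open>The Kleisli doctrine\<close>

lemma (in doctrine) reindex_mem:
  assumes "A \<in> Obj (base P)" "B \<in> Obj (base P)" "f \<in> Hom (base P) A B" "\<alpha> \<in> carrier (fib P B)"
  shows "reindex P A B f \<alpha> \<in> carrier (fib P A)"
  using reindex_closed[OF assms(1-3)] assms(4) by blast

lemma (in doctrine) reindex_le:
  assumes "A \<in> Obj (base P)" "B \<in> Obj (base P)" "f \<in> Hom (base P) A B"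
    and "\<alpha> \<in> carrier (fib P B)" "\<beta> \<in> carrier (fib P B)" "\<alpha> \<sqsubseteq>\<^bsub>fib P B\<^esub> \<beta>"
  shows "reindex P A B f \<alpha> \<sqsubseteq>\<^bsub>fib P A\<^esub> reindex P A B f \<beta>"
  using use_iso2[OF reindex_mono[OF assms(1-3)]] assms(4-6) by blast

locale kleisli = primary_doctrine P for P :: "('o, 'a, 'p) doctrine" +
  fixes X :: 'o and \<phi> :: 'p
  assumes X: "X \<in> Obj (base P)"
    and \<phi>: "\<phi> \<in> carrier (fib P X)"

sublocale kleisli \<subseteq> cat: kleisli_base "base P" X
  using base X by (simp add: kleisli_base_def kleisli_base_axioms_def)

context kleisli
begin

abbreviation XP :: "'o \<Rightarrow> 'o" where "XP \<equiv> Prod (base P) X"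
abbreviation pr1 :: "'o \<Rightarrow> 'a" where "pr1 \<equiv> Proj1 (base P) X"
abbreviation pr2 :: "'o \<Rightarrow> 'a" where "pr2 \<equiv> Proj2 (base P) X"
abbreviation lift :: "'o \<Rightarrow> 'o \<Rightarrow> 'a \<Rightarrow> 'a" where "lift \<equiv> kleisli_lift (base P) X"
abbreviation KD :: "('o, 'a, 'p) doctrine" where "KD \<equiv> kleisli_doctrine P X \<phi>"

text \<open>This element serves twice: as the top of the Kleisli fibre over \<open>A\<close> and as
  the fixed factor of the meet in the canonical 1-arrow.\<close>

definition \<phi>' :: "'o \<Rightarrow> 'p" where "\<phi>' A = reindex P (XP A) X (pr1 A) \<phi>"

lemma kleisli_doctrine_simps:
  "base KD = kleisli_category (base P) X"
  "fib KD A = (fib P (XP A))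
    \<lparr>carrier := {\<alpha> \<in> carrier (fib P (XP A)). \<alpha> \<sqsubseteq>\<^bsub>fib P (XP A)\<^esub> \<phi>' A}\<rparr>"
  "reindex KD A B g = reindex P (XP A) (XP B) (lift A B g)"
  by (simp_all add: kleisli_doctrine_def \<phi>'_def Let_def)

lemma kleisli_arrow_simps:
  "fun_part (kleisli_arrow P X \<phi>) = kleisli_functor (base P) X"
  "component (kleisli_arrow P X \<phi>) A \<alpha> =
    \<phi>' A \<sqinter>\<^bsub>fib P (XP A)\<^esub> reindex P (XP A) A (pr2 A) \<alpha>"
  by (simp_all add: kleisli_arrow_def \<phi>'_def Let_def)

lemma \<phi>'_mem:
  assumes "A \<in> Obj (base P)"
  shows "\<phi>' A \<in> carrier (fib P (XP A))"
  unfolding \<phi>'_def using assms X \<phi> by (intro reindex_mem cat.X_Prod_obj cat.X_Proj1_in_hom)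

lemma reindex_lift_\<phi>':
  assumes "A \<in> Obj (base P)" "B \<in> Obj (base P)" "g \<in> Hom (base P) (XP A) B"
  shows "reindex P (XP A) (XP B) (lift A B g) (\<phi>' B) = \<phi>' A"
  unfolding \<phi>'_def using assms X \<phi>
  \<comment> \<open>Functoriality merges the two reindexings into one along \<open>pr1\<close> after
    the lift, which is \<open>pr1\<close> again.\<close>
  by (subst reindex_comp[symmetric])
    (simp_all add: cat.kleisli_lift cat.X_Prod_obj cat.X_Proj1_in_hom)

text \<open>Monotonicity turns the bound \<open>\<phi>' B\<close> into its image, which is
  \<open>\<phi>' A\<close>; so reindexing along a lift restricts to the down-sets.\<close>

lemma reindex_lift_mem:
  assumes "A \<in> Obj (base P)" "B \<in> Obj (base P)" "g \<in> Hom (base P) (XP A) B"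
    and "\<alpha> \<in> carrier (fib KD B)"
  shows "reindex P (XP A) (XP B) (lift A B g) \<alpha> \<in> carrier (fib KD A)"
proof -
  have "reindex P (XP A) (XP B) (lift A B g) \<alpha> \<sqsubseteq>\<^bsub>fib P (XP A)\<^esub> \<phi>' A"
    using assms reindex_le[of "XP A" "XP B" "lift A B g" \<alpha> "\<phi>' B"]
    by (simp add: reindex_lift_\<phi>' kleisli_doctrine_simps cat.X_Prod_obj cat.kleisli_lift \<phi>'_mem)
  then show ?thesis
    using assms
    by (simp add: kleisli_doctrine_simps reindex_mem cat.X_Prod_obj cat.kleisli_lift)
qed

lemma partial_order_fib_KD:
  assumes "A \<in> Obj (base P)"
  shows "partial_order (fib KD A)"
  unfolding kleisli_doctrine_simps
  by (rule partial_order.partial_order_downset[OF fib[OF cat.X_Prod_obj[OF assms]]])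

lemma doctrine_KD: "doctrine KD"
proof (rule doctrine.intro)
  show "fp_category (base KD)"
    by (simp add: kleisli_doctrine_simps cat.fp_category_kleisli_category)
next
  fix A B f
  assume AB: "A \<in> Obj (base KD)" "B \<in> Obj (base KD)" "f \<in> Hom (base KD) A B"
  then show "reindex KD A B f \<in> carrier (fib KD B) \<rightarrow> carrier (fib KD A)"
    using reindex_lift_mem by (auto simp: kleisli_doctrine_simps cat.kleisli_category_simps)
  show "isotone (fib KD B) (fib KD A) (reindex KD A B f)"
    using AB
    \<comment> \<open>\<open>isotone\<close> also asks that both fibres be weak partial
      orders.\<close>
    by (intro isotoneI partial_order.axioms(1)[OF partial_order_fib_KD])
      (simp_all add: kleisli_doctrine_simps cat.kleisli_category_simps reindex_le
        cat.kleisli_lift cat.X_Prod_obj)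
next
  fix A assume "A \<in> Obj (base KD)"
  then show "partial_order (fib KD A)"
    by (simp add: kleisli_doctrine_simps(1) cat.kleisli_category_simps partial_order_fib_KD)
\<comment> \<open>The two functor laws remain; functoriality of the lift reduces them to those of
  \<open>P\<close>.\<close>
qed (simp_all add: kleisli_doctrine_simps cat.kleisli_category_simps cat.kleisli_lift_Proj2
    cat.kleisli_lift_comp reindex_ident reindex_comp[of _ "XP _"] cat.X_Prod_obj cat.kleisli_lift)

section \<open>The canonical 1-arrow\<close>

lemma component_mem:
  assumes "A \<in> Obj (base P)" "\<alpha> \<in> carrier (fib P A)"
  shows "component (kleisli_arrow P X \<phi>) A \<alpha> \<in> carrier (fib KD A)"
proof -
  interpret L: lower_semilattice "fib P (XP A)"
    by (rule fib_meets[OF cat.X_Prod_obj[OF assms(1)]])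
  show ?thesis
    using assms
    by (simp add: kleisli_doctrine_simps kleisli_arrow_simps \<phi>'_mem reindex_mem cat.X_Prod_obj
        cat.X_Proj2_in_hom L.meet_left)
qed

lemma component_mono:
  assumes "A \<in> Obj (base P)" "\<alpha> \<in> carrier (fib P A)" "\<beta> \<in> carrier (fib P A)"
    and "\<alpha> \<sqsubseteq>\<^bsub>fib P A\<^esub> \<beta>"
  shows "component (kleisli_arrow P X \<phi>) A \<alpha> \<sqsubseteq>\<^bsub>fib KD A\<^esub> component (kleisli_arrow P X \<phi>) A \<beta>"
proof -
  interpret L: lower_semilattice "fib P (XP A)"
    by (rule fib_meets[OF cat.X_Prod_obj[OF assms(1)]])
  let ?r = "reindex P (XP A) A (pr2 A)"
  have mem: "\<phi>' A \<in> carrier (fib P (XP A))" "?r \<alpha> \<in> carrier (fib P (XP A))"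
    "?r \<beta> \<in> carrier (fib P (XP A))"
    using assms by (simp_all add: \<phi>'_mem reindex_mem cat.X_Prod_obj cat.X_Proj2_in_hom)
  have "?r \<alpha> \<sqsubseteq>\<^bsub>fib P (XP A)\<^esub> ?r \<beta>"
    using assms by (intro reindex_le cat.X_Prod_obj cat.X_Proj2_in_hom)
  then have "\<phi>' A \<sqinter>\<^bsub>fib P (XP A)\<^esub> ?r \<alpha> \<sqsubseteq>\<^bsub>fib P (XP A)\<^esub> \<phi>' A \<sqinter>\<^bsub>fib P (XP A)\<^esub> ?r \<beta>"
    using mem by (meson L.meet_le L.meet_left L.meet_right L.meet_closed L.le_trans)
  then show ?thesis
    by (simp add: kleisli_doctrine_simps kleisli_arrow_simps)
qed

text \<open>Reindexing along the lift preserves the meet, so each factor is compared separately: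
  \<open>\<phi>' B\<close> goes to \<open>\<phi>' A\<close>, and the other factor is handled by
  functoriality of \<open>P\<close>.\<close>

lemma component_natural:
  assumes "A \<in> Obj (base P)" "B \<in> Obj (base P)" "f \<in> Hom (base P) A B"
    and "\<beta> \<in> carrier (fib P B)"
  shows "component (kleisli_arrow P X \<phi>) A (reindex P A B f \<beta>) =
    reindex KD A B (on_hom (kleisli_functor (base P) X) A B f)
      (component (kleisli_arrow P X \<phi>) B \<beta>)"
proof -
  let ?g = "Comp (base P) (XP A) A B f (pr2 A)"
  have g: "?g \<in> Hom (base P) (XP A) B"
    using assms by (intro cat.comp_in_hom[of _ A] cat.X_Prod_obj cat.X_Proj2_in_hom)
  note l = cat.kleisli_lift[OF assms(1,2) g]
  \<comment> \<open>\<open>f pr2\<close> factors both as \<open>pr2\<close> followed by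
    \<open>f\<close> and as the lift of \<open>?g\<close> followed by \<open>pr2\<close>.\<close>
  have "reindex P (XP A) (XP B) (lift A B ?g) (reindex P (XP B) B (pr2 B) \<beta>) =
      reindex P (XP A) B ?g \<beta>"
    using assms l
    by (subst reindex_comp[symmetric]) (simp_all add: cat.X_Prod_obj cat.X_Proj2_in_hom)
  also have "\<dots> = reindex P (XP A) A (pr2 A) (reindex P A B f \<beta>)"
    using assms by (intro reindex_comp cat.X_Prod_obj cat.X_Proj2_in_hom)
  finally show ?thesis
    using assms g l
    by (simp add: kleisli_doctrine_simps kleisli_arrow_simps cat.kleisli_functor_simps
        reindex_meet reindex_lift_\<phi>' \<phi>'_mem reindex_mem cat.X_Prod_obj cat.X_Proj2_in_hom)
qed

lemma doctrine_hom_kleisli_arrow: "doctrine_hom P KD (kleisli_arrow P X \<phi>)"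
proof (intro doctrine_hom.intro doctrine_axioms doctrine_KD doctrine_hom_axioms.intro)
  show "fp_functor (base P) (base KD) (fun_part (kleisli_arrow P X \<phi>))"
    by (simp add: kleisli_doctrine_simps kleisli_arrow_simps cat.fp_functor_kleisli_functor)
next
  fix A assume A: "A \<in> Obj (base P)"
  show "component (kleisli_arrow P X \<phi>) A \<in>
      carrier (fib P A) \<rightarrow> carrier (fib KD (on_obj (fun_part (kleisli_arrow P X \<phi>)) A))"
    using component_mem[OF A] by (auto simp: kleisli_arrow_simps(1) cat.kleisli_functor_simps)
  show "isotone (fib P A) (fib KD (on_obj (fun_part (kleisli_arrow P X \<phi>)) A))
      (component (kleisli_arrow P X \<phi>) A)"
    unfolding kleisli_arrow_simps(1) cat.kleisli_functor_simps
    using A component_mono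
    by (intro isotoneI partial_order.axioms(1)[OF partial_order_fib_KD]
        partial_order.axioms(1)[OF fib])
qed (simp add: component_natural kleisli_arrow_simps(1) cat.kleisli_functor_simps(1))

lemma greatest_fib_KD:
  assumes "A \<in> Obj (base P)"
  shows "greatest (fib KD A) (\<phi>' A) (carrier (fib KD A))"
  using weak_partial_order.greatest_downset[OF partial_order.axioms(1)[OF
      fib[OF cat.X_Prod_obj[OF assms]]] \<phi>'_mem[OF assms]]
  by (simp add: kleisli_doctrine_simps)

end

section \<open>Bounds of the Kleisli fibres and their preservation\<close>

locale bounded_kleisli = kleisli P X \<phi> + bounded: bounded_doctrine P
  for P :: "('o, 'a, 'p) doctrine" and X :: 'o and \<phi> :: 'p
begin

lemma least_fib_KD:
  assumes "A \<in> Obj (base P)"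
  shows "least (fib KD A) \<bottom>\<^bsub>fib P (XP A)\<^esub> (carrier (fib KD A))"
  using weak_partial_order_bottom.least_downset[OF
      bounded.fib_bottom[OF cat.X_Prod_obj[OF assms]] \<phi>'_mem[OF assms]]
  by (simp add: kleisli_doctrine_simps)

lemma top_fib_KD:
  assumes "A \<in> Obj (base P)"
  shows "\<top>\<^bsub>fib KD A\<^esub> = \<phi>' A"
  using partial_order.top_equality[OF partial_order_fib_KD greatest_fib_KD] assms by blast

lemma bottom_fib_KD:
  assumes "A \<in> Obj (base P)"
  shows "\<bottom>\<^bsub>fib KD A\<^esub> = \<bottom>\<^bsub>fib P (XP A)\<^esub>"
  using partial_order.bottom_equality[OF partial_order_fib_KD least_fib_KD] assms by blast

lemma bounded_doctrine_KD: "bounded_doctrine KD"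
proof -
  have obj: "A \<in> Obj (base P)" if "A \<in> Obj (base KD)" for A
    using that by (simp add: kleisli_doctrine_simps cat.kleisli_category_simps)
  show ?thesis
  proof (intro bounded_doctrine.intro doctrine_KD bounded_doctrine_axioms.intro)
    fix A assume "A \<in> Obj (base KD)"
    then have A: "A \<in> Obj (base P)" by (rule obj)
    interpret L: partial_order "fib KD A"
      by (rule partial_order_fib_KD[OF A])
    show "weak_partial_order_top (fib KD A)"
      using greatest_fib_KD[OF A] by unfold_locales blast
    show "weak_partial_order_bottom (fib KD A)"
      using least_fib_KD[OF A] by unfold_locales blast
  next
    fix A B f
    assume "A \<in> Obj (base KD)" "B \<in> Obj (base KD)" and f: "f \<in> Hom (base KD) A B"
    then have AB: "A \<in> Obj (base P)" "B \<in> Obj (base P)" by (simp_all add: obj)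
    have f: "f \<in> Hom (base P) (XP A) B"
      using f by (simp add: kleisli_doctrine_simps cat.kleisli_category_simps)
    show "reindex KD A B f \<top>\<^bsub>fib KD B\<^esub> = \<top>\<^bsub>fib KD A\<^esub>"
      using AB f by (simp add: top_fib_KD kleisli_doctrine_simps(3) reindex_lift_\<phi>')
    show "reindex KD A B f \<bottom>\<^bsub>fib KD B\<^esub> = \<bottom>\<^bsub>fib KD A\<^esub>"
      using AB f
      \<comment> \<open>Both bottoms are those of \<open>P\<close> over \<open>XP B\<close> and
        \<open>XP A\<close>, and the lift is an arrow of the base, so \<open>P\<close> already
        preserves them.\<close>
      by (simp add: bottom_fib_KD kleisli_doctrine_simps(3) bounded.reindex_bottom
          cat.X_Prod_obj cat.kleisli_lift)
  qed
qed

lemma preserves_bottom_kleisli_arrow: "preserves_bottom P KD (kleisli_arrow P X \<phi>)"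
  unfolding preserves_bottom_def
proof
  fix A assume A: "A \<in> Obj (base P)"
  note XA = cat.X_Prod_obj[OF A]
  interpret L: lower_semilattice "fib P (XP A)"
    by (rule fib_meets[OF XA])
  interpret L: weak_partial_order_bottom "fib P (XP A)"
    by (rule bounded.fib_bottom[OF XA])
  have "\<phi>' A \<sqinter>\<^bsub>fib P (XP A)\<^esub> \<bottom>\<^bsub>fib P (XP A)\<^esub> = \<bottom>\<^bsub>fib P (XP A)\<^esub>"
    \<comment> \<open>The meet lies below its right factor, the bottom; the converse inequality is
      leastness.\<close>
    using \<phi>'_mem[OF A] by (intro L.le_antisym L.meet_right) auto
  then show "component (kleisli_arrow P X \<phi>) A \<bottom>\<^bsub>fib P A\<^esub> =
      \<bottom>\<^bsub>fib KD (on_obj (fun_part (kleisli_arrow P X \<phi>)) A)\<^esub>"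
    using A XA
    by (simp add: kleisli_arrow_simps cat.kleisli_functor_simps bottom_fib_KD
        bounded.reindex_bottom cat.X_Proj2_in_hom)
qed

end

theorem proposition5p8:
  fixes P :: "('o, 'a, 'p) doctrine" and X :: 'o and \<phi> :: 'p
  assumes "primary_doctrine P"
    and "X \<in> Obj (base P)"
    and "\<phi> \<in> carrier (fib P X)"
    and "bounded_doctrine P"
  shows "bounded_doctrine (kleisli_doctrine P X \<phi>) \<and>
    doctrine_hom P (kleisli_doctrine P X \<phi>) (kleisli_arrow P X \<phi>) \<and>
    preserves_bottom P (kleisli_doctrine P X \<phi>) (kleisli_arrow P X \<phi>)"
proof -
  interpret bounded_kleisli P X \<phi>
    using assms by (simp add: bounded_kleisli_def kleisli_def kleisli_axioms_def)
  show ?thesis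
    using bounded_doctrine_KD doctrine_hom_kleisli_arrow preserves_bottom_kleisli_arrow by blast
qed

end
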